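(* Let $(a_n)_{n \geq 1} = (0,1,2,4,5,7,\ldots)$ be the sequence of Rudin--Shapiro integers, i.e., the sequence of all integers $k \geq 0$ with $r_k = 1$, sorted in increasing order, where $(r_k)_{k \geq 0}$ is the Rudin--Shapiro sequence. Then the additive energy satisfies $$E(\{a_1, \ldots, a_N\}) \gg N^3,$$ and for (Lebesgue) almost all $\alpha \in \mathbb{R}$ the star-discrepancy $D_N^* = D_N^*(\{a_1\alpha\}, \ldots, \{a_N\alpha\})$ of $(\{a_n \alpha\})_{n \geq 1}$ satisfies $$N D_N^* = \Omega\left(N^{\frac12 - \varepsilon}\right) \quad \text{for all } \varepsilon > 0.$$
   Context: The Rudin--Shapiro sequence $(r_0, r_1, r_2, \ldots) = (1,1,1,-1,1,1,-1,1,\ldots)$ is defined by $r_k = 1$ if the number of (possibly overlapping) $11$-blocks in the base $2$ representation of $k$ is even, and $r_k = -1$ otherwise. $\{x\}$ denotes the fractional part of a real number $x$. For points $x_1, \ldots, x_N \in [0,1)$ the star-discrepancy is $D_N^*(x_1,\ldots,x_N) := \sup_{0 < \beta \leq 1} \left| \frac{A_N(\beta)}{N} - \beta \right|$, where $A_N(\beta) := \#\{1 \leq n \leq N : x_n \in [0,\beta)\}$. The additive energy of a finite set $A$ of integers is $E(A) := \#\{(x_1,x_2,x_3,x_4) \in A^4 : x_1 - x_2 = x_3 - x_4\}$. $f(N) \gg g(N)$ means that there is a constant $c > 0$ with $f(N) \geq c\, g(N)$ for all $N \geq 1$, and $f(N) = \Omega(g(N))$ means that there is a constant $c > 0$ with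 $f(N) \geq c\, g(N)$ for infinitely many $N$. *)

theory Defs
  imports "HOL-Analysis.Analysis"
begin

text \<open>Each (possibly overlapping) block 11 in the binary expansion of \<open>k\<close> is identified by the
  position \<open>i\<close> of its less significant digit.\<close>

definition blocks11 :: "nat \<Rightarrow> nat" where
  "blocks11 k = card {i. bit k i \<and> bit k (Suc i)}"

definition rudin_shapiro :: "nat \<Rightarrow> int" where
  "rudin_shapiro k = (if even (blocks11 k) then 1 else - 1)"

definition rudin_shapiro_set :: "nat set" where
  "rudin_shapiro_set = {k. rudin_shapiro k = 1}"

text \<open>The sequence \<open>(a\<^sub>n)\<close> is indexed from 1, whereas \<^const>\<open>enumerate\<close> counts from 0; the value at
  \<open>n = 0\<close> is irrelevant. Infinitude of the set (lemma \<open>infinite_rudin_shapiro_set\<close> below) ensures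
  that \<^const>\<open>enumerate\<close> lists it in increasing order.\<close>

definition rudin_shapiro_integer :: "nat \<Rightarrow> nat" where
  "rudin_shapiro_integer n = enumerate rudin_shapiro_set (n - 1)"

definition additive_energy :: "int set \<Rightarrow> nat" where
  "additive_energy A =
     card {(x1, x2, x3, x4). x1 \<in> A \<and> x2 \<in> A \<and> x3 \<in> A \<and> x4 \<in> A \<and> x1 - x2 = x3 - x4}"

text \<open>Star-discrepancy of the points \<open>x 1, \<dots>, x N\<close>, for \<open>N \<ge> 1\<close>.\<close>

definition star_discrepancy :: "(nat \<Rightarrow> real) \<Rightarrow> nat \<Rightarrow> real" where
  "star_discrepancy x N =
     (SUP \<beta>\<in>{0<..1}. \<bar>real (card {n \<in> {1..N}. x n \<in> {0..<\<beta>}}) / real N - \<beta>\<bar>)"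

lemma bdd_above_star_discrepancy:
  "bdd_above ((\<lambda>\<beta>. \<bar>real (card {n \<in> {1..N}. x n \<in> {0..<\<beta>}}) / real N - \<beta>\<bar>) ` {0<..1})"
proof (rule bdd_aboveI2)
  fix \<beta> :: real assume b: "\<beta> \<in> {0<..1}"
  have "card {n \<in> {1..N}. x n \<in> {0..<\<beta>}} \<le> card {1..N}"
    by (rule card_mono) auto
  then have "real (card {n \<in> {1..N}. x n \<in> {0..<\<beta>}}) / real N \<le> 1"
    by (cases "N = 0") (auto simp: divide_le_eq_1)
  moreover have "0 \<le> real (card {n \<in> {1..N}. x n \<in> {0..<\<beta>}}) / real N"
    by simp
  ultimately show "\<bar>real (card {n \<in> {1..N}. x n \<in> {0..<\<beta>}}) / real N - \<beta>\<bar> \<le> 1"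
    using b unfolding abs_le_iff greaterThanAtMost_iff by linarith
qed

lemma infinite_rudin_shapiro_set: "infinite rudin_shapiro_set"
proof -
  have "2 ^ j \<in> rudin_shapiro_set" for j :: nat
  proof -
    have "{i. bit (2 ^ j :: nat) i \<and> bit (2 ^ j :: nat) (Suc i)} = {}"
      by (auto simp: bit_exp_iff)
    then show ?thesis
      unfolding rudin_shapiro_set_def rudin_shapiro_def blocks11_def by (simp only: mem_Collect_eq card.empty) simp
  qed
  then have "range (\<lambda>j. 2 ^ j) \<subseteq> rudin_shapiro_set" by blast
  moreover have "infinite (range (\<lambda>j. 2 ^ j :: nat))"
    by (rule range_inj_infinite) (simp add: inj_on_def)
  ultimately show ?thesis using finite_subset by blast
qed

end

theory Submission
  imports Defs
begin

text \<open>The Rudin--Shapiro polynomials \<open>P\<^sub>m(z) = \<Sum>k<2^m. r\<^sub>k z^k\<close> and their companions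
  \<open>Q\<^sub>m(z) = \<Sum>k<2^m. r\<^bsub>2^m+k\<^esub> z^k\<close> satisfy \<open>P\<^bsub>m+1\<^esub> = P\<^sub>m + z^(2^m) Q\<^sub>m\<close> and
  \<open>Q\<^bsub>m+1\<^esub> = P\<^sub>m - z^(2^m) Q\<^sub>m\<close>, so by the parallelogram law \<open>\<bar>P\<^sub>m\<bar>\<^sup>2 + \<bar>Q\<^sub>m\<bar>\<^sup>2 = 2^(m+1)\<close> on the unit
  circle. At \<open>z = 1\<close> this shows that the Rudin--Shapiro integers have positive lower density, and a
  set of \<open>N\<close> integers in an interval of length \<open>O(N)\<close> has additive energy of order \<open>N\<^sup>3\<close> by
  Cauchy--Schwarz. At \<open>z = exp(2\<pi>i\<alpha>)\<close> with \<open>\<alpha>\<close> not an integer it shows that one of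
  \<open>\<bar>P\<^sub>m\<bar>\<close>, \<open>\<bar>P\<^bsub>m+1\<^esub>\<bar>\<close> is at least of order \<open>2^(m/2)\<close>; the exponential sum over the Rudin--Shapiro
  integers below \<open>2^m\<close> is half of \<open>P\<^sub>m\<close> up to a bounded geometric sum, and the discrepancy dominates
  exponential sums by Koksma's inequality.\<close>

section \<open>Binary digits and the sign recursion\<close>

lemma bit_power_of_two_add:
  fixes k :: nat
  assumes "k < 2 ^ m"
  shows "bit (2 ^ m + k) i \<longleftrightarrow> i = m \<or> bit k i"
proof -
  have nb: "\<not> bit k j" if "m \<le> j" for j
    using assms that by (metis bit_take_bit_iff not_less take_bit_nat_eq_self)
  have "2 ^ m + k = or (2 ^ m) k"
    by (intro disjunctive_add_eq_or bit_eqI) (use nb in \<open>auto simp: bit_and_iff bit_exp_iff\<close>)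
  then show ?thesis
    by (auto simp: bit_or_iff bit_exp_iff)
qed

text \<open>All digits of \<open>k\<close> from position \<open>Suc m\<close> on vanish, so a new
  leading 1 there can only complete the block whose lower digit is at \<open>m\<close>.\<close>

lemma blocks11_power_of_two_add:
  assumes "k < 2 ^ Suc m"
  shows "blocks11 (2 ^ Suc m + k) = blocks11 k + of_bool (bit k m)"
proof -
  have nb: "\<not> bit k j" if "Suc m \<le> j" for j
    using assms that by (metis bit_take_bit_iff not_less take_bit_nat_eq_self)
  define S where "S = {i. bit k i \<and> bit k (Suc i)}"
  have S: "S \<subseteq> {..<m}"
    unfolding S_def using nb by (metis (mono_tags, lifting) lessThan_iff linorder_not_le mem_Collect_eq not_less_eq_eq subsetI)
  then have fin: "finite S" and m: "m \<notin> S"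
    by (auto intro: finite_subset)
  have "{i. bit (2 ^ Suc m + k) i \<and> bit (2 ^ Suc m + k) (Suc i)} = (if bit k m then insert m S else S)"
    using nb[of "Suc m"] nb[of "Suc (Suc m)"]
    by (auto simp: bit_power_of_two_add[OF assms] S_def simp del: power_Suc)
  then show ?thesis
    using fin m by (simp add: blocks11_def S_def del: power_Suc)
qed

text \<open>Leading digits 10 create no new block, whereas leading digits 11 in the next lemma
  create one and flip the sign. These are the two halves of the recursion for the companion.\<close>

lemma rudin_shapiro_add_low:
  assumes "k < 2 ^ m"
  shows "rudin_shapiro (2 ^ Suc m + k) = rudin_shapiro k"
proof -
  have "\<not> bit k m"
    using assms by (metis bit_take_bit_iff less_irrefl take_bit_nat_eq_self)
  moreover have "k < 2 ^ Suc m" using assms by simp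
  ultimately show ?thesis
    by (simp add: rudin_shapiro_def blocks11_power_of_two_add del: power_Suc)
qed

lemma rudin_shapiro_add_high:
  assumes "k < 2 ^ m"
  shows "rudin_shapiro (2 ^ Suc m + (2 ^ m + k)) = - rudin_shapiro (2 ^ m + k)"
proof -
  have "bit (2 ^ m + k) m"
    using assms by (simp add: bit_power_of_two_add)
  moreover have "2 ^ m + k < 2 ^ Suc m" using assms by simp
  ultimately show ?thesis
    by (simp add: rudin_shapiro_def blocks11_power_of_two_add del: power_Suc)
qed

section \<open>Rudin--Shapiro polynomials on the unit circle\<close>

definition rs_poly :: "nat \<Rightarrow> complex \<Rightarrow> complex" where
  "rs_poly m z = (\<Sum>k<2 ^ m. of_int (rudin_shapiro k) * z ^ k)"

definition rs_companion :: "nat \<Rightarrow> complex \<Rightarrow> complex" where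
  "rs_companion m z = (\<Sum>k<2 ^ m. of_int (rudin_shapiro (2 ^ m + k)) * z ^ k)"

lemma sum_lessThan_power_of_two_Suc:
  fixes f :: "nat \<Rightarrow> 'a :: comm_monoid_add"
  shows "(\<Sum>k<2 ^ Suc m. f k) = (\<Sum>k<2 ^ m. f k) + (\<Sum>k<2 ^ m. f (2 ^ m + k))"
proof -
  have "(\<Sum>k<m + n. f k) = (\<Sum>k<m. f k) + (\<Sum>k<n. f (m + k))" for m n
    by (induction n) (simp_all add: add.assoc)
  then show ?thesis by (simp add: mult_2)
qed

lemma rs_poly_Suc: "rs_poly (Suc m) z = rs_poly m z + z ^ (2 ^ m) * rs_companion m z"
  unfolding rs_poly_def rs_companion_def sum_lessThan_power_of_two_Suc
  by (simp add: power_add sum_distrib_left mult_ac)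

lemma rs_companion_Suc: "rs_companion (Suc m) z = rs_poly m z - z ^ (2 ^ m) * rs_companion m z"
proof -
  have "rs_companion (Suc m) z =
      (\<Sum>k<2 ^ m. of_int (rudin_shapiro (2 ^ Suc m + k)) * z ^ k) +
      (\<Sum>k<2 ^ m. of_int (rudin_shapiro (2 ^ Suc m + (2 ^ m + k))) * z ^ (2 ^ m + k))"
    unfolding rs_companion_def sum_lessThan_power_of_two_Suc ..
  also have "\<dots> = (\<Sum>k<2 ^ m. of_int (rudin_shapiro k) * z ^ k) +
      (\<Sum>k<2 ^ m. - (z ^ (2 ^ m) * (of_int (rudin_shapiro (2 ^ m + k)) * z ^ k)))"
    by (intro arg_cong2[where f = "(+)"] sum.cong refl)
       (simp_all add: rudin_shapiro_add_low rudin_shapiro_add_high power_add del: power_Suc)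
  finally show ?thesis
    by (simp add: rs_poly_def rs_companion_def sum_distrib_left sum_negf)
qed

lemma rs_poly_0: "rs_poly 0 z = 1" and rs_companion_0: "rs_companion 0 z = 1"
proof -
  have "rudin_shapiro 0 = 1" by (simp add: rudin_shapiro_def blocks11_def)
  moreover have "rudin_shapiro (Suc 0) = 1" by (simp add: rudin_shapiro_def blocks11_def)
  ultimately show "rs_poly 0 z = 1" "rs_companion 0 z = 1"
    by (simp_all add: rs_poly_def rs_companion_def)
qed

lemma rs_poly_companion_norm:
  assumes "norm z = 1"
  shows "(norm (rs_poly m z))\<^sup>2 + (norm (rs_companion m z))\<^sup>2 = 2 ^ Suc m"
proof (induction m)
  case 0
  show ?case by (simp add: rs_poly_0 rs_companion_0)
next
  case (Suc m)
  have parallelogram: "(norm (u + v))\<^sup>2 + (norm (u - v))\<^sup>2 = 2 * ((norm u)\<^sup>2 + (norm v)\<^sup>2)" for u v :: complex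
    by (simp add: power2_norm_eq_inner inner_simps inner_commute)
  show ?case
    unfolding rs_poly_Suc rs_companion_Suc parallelogram
    using Suc assms by (simp add: norm_mult norm_power)
qed

text \<open>One of \<open>m = K\<close> and \<open>m = Suc K\<close> works: if
  \<open>rs_poly K z\<close> is small, the norm identity makes \<open>rs_companion K z\<close>
  large, and that term dominates \<open>rs_poly (Suc K) z\<close>.\<close>

lemma rs_poly_large:
  assumes "norm z = 1"
  shows "\<exists>m\<ge>K. norm (rs_poly m z) \<ge> sqrt (2 ^ m) / 4"
proof (rule ccontr)
  assume "\<not> ?thesis"
  then have small: "norm (rs_poly m z) < sqrt (2 ^ m) / 4" if "m \<ge> K" for m
    using that not_less by blast
  define s :: real where "s = sqrt (2 ^ K)"
  have s: "s > 0" "s\<^sup>2 = 2 ^ K" by (simp_all add: s_def)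
  have P: "norm (rs_poly K z) < s / 4" using small[of K] by (simp add: s_def)
  have "(norm (rs_poly K z))\<^sup>2 \<le> (s / 4)\<^sup>2"
    using P by (intro power_mono) auto
  then have "(norm (rs_poly K z))\<^sup>2 \<le> s\<^sup>2 / 16"
    by (simp add: power_divide)
  moreover have "(norm (rs_poly K z))\<^sup>2 + (norm (rs_companion K z))\<^sup>2 = 2 * s\<^sup>2"
    using rs_poly_companion_norm[OF assms, of K] s(2) by simp
  \<comment> \<open>The companion's squared norm is at least (2 - 1/16) s^2, and 31/16 >= 25/16. The
    value 5/4 leaves 5/4 s - s/4 = s for the next polynomial.\<close>
  moreover have "(5 / 4 * s)\<^sup>2 = 25 / 16 * s\<^sup>2" by (simp add: power_mult_distrib power_divide)
  ultimately have "(5 / 4 * s)\<^sup>2 \<le> (norm (rs_companion K z))\<^sup>2"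
    using zero_le_power2[of s] by linarith
  then have Q: "norm (rs_companion K z) \<ge> 5 / 4 * s"
    by (rule power2_le_imp_le) auto
  have "norm (rs_companion K z) - norm (rs_poly K z) \<le> norm (rs_poly (Suc K) z)"
    unfolding rs_poly_Suc using norm_diff_ineq[of "z ^ (2 ^ K) * rs_companion K z" "rs_poly K z"] assms
    by (simp add: norm_mult norm_power add.commute)
  then have "s \<le> norm (rs_poly (Suc K) z)" using P Q by linarith
  also have "\<dots> < sqrt 2 * s / 4" using small[of "Suc K"] by (simp add: s_def real_sqrt_mult)
  also have "\<dots> < s" using s(1) sqrt2_less_2 by simp
  finally show False .
qed

section \<open>Counting and enumerating the Rudin--Shapiro integers below 2^m\<close>

abbreviation rs_below :: "nat \<Rightarrow> nat set" where
  "rs_below m \<equiv> {k \<in> rudin_shapiro_set. k < 2 ^ m}"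

text \<open>The indicator function of the set is (1 + r_k)/2.\<close>

lemma rs_below_power_sum:
  fixes z :: complex
  shows "(\<Sum>k\<in>rs_below m. z ^ k) = ((\<Sum>k<2 ^ m. z ^ k) + rs_poly m z) / 2"
proof -
  have "(\<Sum>k\<in>rs_below m. z ^ k) = (\<Sum>k\<in>{k \<in> {..<2 ^ m}. k \<in> rudin_shapiro_set}. z ^ k)"
    by (rule sum.cong) auto
  also have "\<dots> = (\<Sum>k<2 ^ m. if k \<in> rudin_shapiro_set then z ^ k else 0)"
    by (rule sum.inter_filter) auto
  also have "\<dots> = (\<Sum>k<2 ^ m. (z ^ k + of_int (rudin_shapiro k) * z ^ k) / 2)"
    by (rule sum.cong) (auto simp: rudin_shapiro_set_def rudin_shapiro_def)
  finally show ?thesis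
    by (simp add: rs_poly_def sum.distrib flip: sum_divide_distrib)
qed

lemma card_rs_below_le: "card (rs_below m) \<le> 2 ^ m"
  using card_mono[of "{..<2 ^ m}" "rs_below m"] by auto

lemma card_rs_below_ge:
  assumes "m \<ge> 3"
  shows "2 ^ m \<le> 4 * card (rs_below m)"
proof -
  have "of_nat (card (rs_below m)) = (2 ^ m + rs_poly m 1) / (2 :: complex)"
    using rs_below_power_sum[of 1 m] by simp
  then have eq: "rs_poly m 1 = of_real (2 * real (card (rs_below m)) - 2 ^ m)"
    by (simp add: field_simps)
  have "(norm (rs_poly m 1))\<^sup>2 \<le> 2 ^ Suc m"
    using rs_poly_companion_norm[of 1 m] by (metis le_add_same_cancel1 norm_one zero_le_power2)
  \<comment> \<open>The exponents compare as m + 1 <= 2(m - 1), which is where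
    \<open>m \<ge> 3\<close> enters.\<close>
  also have "\<dots> \<le> (2 ^ (m - 1))\<^sup>2"
    using assms by (simp add: power_mult[symmetric] del: power_Suc)
  finally have "norm (rs_poly m 1) \<le> 2 ^ (m - 1)"
    by (rule power2_le_imp_le) simp
  then have "\<bar>2 * real (card (rs_below m)) - 2 ^ m\<bar> \<le> 2 ^ (m - 1)"
    unfolding eq norm_of_real .
  moreover have "(2 :: real) ^ m = 2 * 2 ^ (m - 1)"
    using assms by (cases m) auto
  ultimately have "2 ^ m \<le> 4 * real (card (rs_below m))" by linarith
  then have "real (2 ^ m) \<le> real (4 * card (rs_below m))" by simp
  then show ?thesis by (simp only: of_nat_le_iff)
qed

lemma enumerate_image_lessThan_card:
  fixes S :: "nat set"
  assumes "infinite S"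
  shows "enumerate S ` {..<card {s \<in> S. s < M}} = {s \<in> S. s < M}"
proof -
  define I where "I = {n. enumerate S n < M}"
  have mono: "strict_mono (enumerate S)"
    using assms by (simp add: strict_mono_enumerate)
  have inj: "inj_on (enumerate S) A" for A
    using mono strict_mono_imp_inj_on inj_on_subset by blast
  have img: "enumerate S ` I = {s \<in> S. s < M}"
    using range_enumerate[OF assms] by (auto simp: I_def)
  have fin: "finite I"
    using finite_imageD[OF _ inj, of I] img by simp
  have "I = {..<card I}"
  proof -
    have "I \<noteq> UNIV" using fin by auto
    then obtain n where "n \<notin> I" by auto
    \<comment> \<open>By monotonicity \<open>I\<close> is downward closed, hence equal to the
      initial segment below its least missing index.\<close>
    define k where "k = (LEAST n. n \<notin> I)"
    have "k \<notin> I" unfolding k_def using \<open>n \<notin> I\<close> by (rule LeastI)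
    have "I = {..<k}"
    proof (intro set_eqI iffI)
      fix j assume "j \<in> I"
      show "j \<in> {..<k}"
      proof (rule ccontr)
        assume "j \<notin> {..<k}"
        then have "enumerate S k \<le> enumerate S j"
          using mono by (simp add: strict_mono_less_eq)
        then show False using \<open>j \<in> I\<close> \<open>k \<notin> I\<close> by (auto simp: I_def)
      qed
    next
      fix j assume "j \<in> {..<k}"
      then show "j \<in> I" using not_less_Least unfolding k_def by blast
    qed
    then show ?thesis by simp
  qed
  moreover have "card I = card {s \<in> S. s < M}"
    using card_image[OF inj, of I] img by simp
  ultimately show ?thesis using img by simp
qed

lemma inj_on_rudin_shapiro_integer: "inj_on rudin_shapiro_integer {1..N}"
proof (rule inj_onI)
  fix i j assume "i \<in> {1..N}" "j \<in> {1..N}" "rudin_shapiro_integer i = rudin_shapiro_integer j"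
  moreover have "inj (enumerate rudin_shapiro_set)"
    by (simp add: infinite_rudin_shapiro_set strict_mono_enumerate strict_mono_imp_inj_on)
  ultimately have "i - 1 = j - 1" by (auto simp: rudin_shapiro_integer_def dest: injD)
  then show "i = j" using \<open>i \<in> {1..N}\<close> \<open>j \<in> {1..N}\<close> by auto
qed

text \<open>With this choice of \<open>N\<close> the first \<open>N\<close> terms are exactly the
  elements below 2^m, so sums over them reduce to \<open>rs_poly m\<close>.\<close>

lemma rudin_shapiro_integer_image:
  "rudin_shapiro_integer ` {1..card (rs_below m)} = rs_below m"
proof -
  have "rudin_shapiro_integer ` {1..N} = enumerate rudin_shapiro_set ` {..<N}" for N
  proof -
    have "{1..N} = Suc ` {..<N}" by (simp add: lessThan_atLeast0 atLeastLessThanSuc_atLeastAtMost)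
    then show ?thesis by (simp add: rudin_shapiro_integer_def image_image)
  qed
  then show ?thesis
    by (simp add: enumerate_image_lessThan_card infinite_rudin_shapiro_set)
qed

lemma rudin_shapiro_integer_less:
  assumes "N \<ge> 1" "n \<in> {1..N}"
  shows "rudin_shapiro_integer n < 16 * N"
proof -
  \<comment> \<open>The factor 8 ensures \<open>Suc m \<ge> 3\<close>, so the density bound 1/4
    yields more than 2N elements below 2^(m+1), which is at most 16N.\<close>
  obtain m where m: "2 ^ m \<le> 8 * N" "8 * N < 2 ^ Suc m"
    using ex_power_ivl1[of 2 "8 * N"] assms by auto
  have "(2 :: nat) ^ 3 < 2 ^ Suc m" using m assms by simp
  then have "Suc m \<ge> 3" using power_less_imp_less_exp[of "2::nat" 3 "Suc m"] by simp
  from card_rs_below_ge[OF this] m have "N \<le> card (rs_below (Suc m))" by linarith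
  then have "n \<in> {1..card (rs_below (Suc m))}" using assms by auto
  then have "rudin_shapiro_integer n \<in> rs_below (Suc m)"
    using rudin_shapiro_integer_image by blast
  then have "rudin_shapiro_integer n < 2 * 2 ^ m" by simp
  with m(1) show ?thesis by linarith
qed

section \<open>Additive energy\<close>

text \<open>Cauchy--Schwarz for the representation counts of differences: they sum to |A|^2, their
  squares sum to the energy, and at most 2L differences occur.\<close>

lemma additive_energy_lower_bound:
  fixes A :: "int set"
  assumes "A \<subseteq> {0..<int L}"
  shows "real (card A) ^ 4 \<le> 2 * real L * real (additive_energy A)"
proof -
  have fin: "finite A" using assms finite_subset by blast
  define D where "D = {- int L..<int L}"
  define R where "R d = {p \<in> A \<times> A. fst p - snd p = d}" for d
  have finR: "finite (R d)" for d by (simp add: R_def fin)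
  have D: "x - y \<in> D" if "x \<in> A" "y \<in> A" for x y
    using subsetD[OF assms that(1)] subsetD[OF assms that(2)] by (simp add: D_def)
  then have "(\<Union>d\<in>D. R d) = A \<times> A"
    by (auto simp: R_def)
  then have "card (A \<times> A) = (\<Sum>d\<in>D. card (R d))"
    using card_UN_disjoint[of D R] finR by (auto simp: D_def R_def)
  then have card: "real (card A) ^ 2 = (\<Sum>d\<in>D. real (card (R d)))"
    by (simp add: card_cartesian_product power2_eq_square flip: of_nat_sum of_nat_mult)
  have "{(x1, x2, x3, x4). x1 \<in> A \<and> x2 \<in> A \<and> x3 \<in> A \<and> x4 \<in> A \<and> x1 - x2 = x3 - x4}
      = (\<lambda>((a, b), (c, d)). (a, b, c, d)) ` (\<Union>d\<in>D. R d \<times> R d)" (is "?E = ?f ` ?U")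
  proof (rule equalityI)
    show "?E \<subseteq> ?f ` ?U"
    proof clarify
      fix a b c d assume "a \<in> A" "b \<in> A" "c \<in> A" "d \<in> A" "a - b = c - d"
      then have "((a, b), (c, d)) \<in> ?U"
        using D[of c d] by (auto simp: R_def)
      then show "(a, b, c, d) \<in> ?f ` ?U" by (rule rev_image_eqI) simp
    qed
  qed (auto simp: R_def)
  moreover have "inj_on ?f ?U"
    by (auto intro!: inj_onI)
  ultimately have "additive_energy A = card ?U"
    by (simp only: additive_energy_def card_image)
  also have "\<dots> = (\<Sum>d\<in>D. card (R d \<times> R d))"
    using finR by (intro card_UN_disjoint) (auto simp: D_def R_def)
  finally have energy: "real (additive_energy A) = (\<Sum>d\<in>D. (real (card (R d)))\<^sup>2)"
    by (simp add: card_cartesian_product power2_eq_square)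
  have "real (card A) ^ 4 = (\<Sum>d\<in>D. real (card (R d)))\<^sup>2"
    unfolding card[symmetric] by simp
  also have "\<dots> \<le> (\<Sum>d\<in>D. (real (card (R d)))\<^sup>2) * (\<Sum>d\<in>D. 1\<^sup>2)"
    using Cauchy_Schwarz_ineq_sum[of "\<lambda>d. real (card (R d))" "\<lambda>_. 1" D] by simp
  also have "\<dots> = 2 * real L * real (additive_energy A)"
    by (simp add: energy D_def)
  finally show ?thesis .
qed

lemma additive_energy_rudin_shapiro:
  assumes "N \<ge> 1"
  shows "real (additive_energy ((\<lambda>n. int (rudin_shapiro_integer n)) ` {1..N})) \<ge> 1 / 32 * real N ^ 3"
    (is "real (additive_energy ?A) \<ge> _")
proof -
  have "?A \<subseteq> {0..<int (16 * N)}"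
    using rudin_shapiro_integer_less[OF assms] by fastforce
  moreover have "card ?A = N"
  proof -
    have "inj_on (\<lambda>n. int (rudin_shapiro_integer n)) {1..N}"
      using inj_on_rudin_shapiro_integer[of N] unfolding inj_on_def of_nat_eq_iff .
    then show ?thesis by (simp add: card_image)
  qed
  \<comment> \<open>Here L = 16N, so 2L = 32N accounts for the constant 1/32.\<close>
  ultimately have "real N ^ 4 \<le> 2 * real (16 * N) * real (additive_energy ?A)"
    using additive_energy_lower_bound by metis
  then have "real N * real N ^ 3 \<le> real N * (32 * real (additive_energy ?A))"
    by (simp add: power_numeral_reduce)
  then have "real N ^ 3 \<le> 32 * real (additive_energy ?A)"
    using assms by (subst (asm) mult_le_cancel_left_pos) auto
  then show ?thesis by simp
qed

section \<open>Discrepancy and exponential sums\<close>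

text \<open>Koksma's inequality for \<open>t \<mapsto> exp(2\<pi>it)\<close>: integrating by parts, the exponential sum is
  \<open>- \<integral>\<^sub>0\<^sup>1 (A\<^sub>N(t) - N t) d(exp(2\<pi>it))\<close>.\<close>

lemma norm_exponential_sum_le_star_discrepancy:
  fixes x :: "nat \<Rightarrow> real"
  assumes x: "\<And>n. n \<in> {1..N} \<Longrightarrow> x n \<in> {0..<1}" and "N \<ge> 1"
  shows "norm (\<Sum>n=1..N. cis (2 * pi * x n)) \<le> 2 * pi * (real N * star_discrepancy x N)"
proof -
  define e where "e t = cis (2 * pi * t)" for t :: real
  define e' where "e' t = of_real (2 * pi) * \<i> * e t" for t :: real
  have deriv: "(e has_vector_derivative e' t) (at t within S)" for t S
    using exp_scaleR_has_vector_derivative_right[of "of_real (2 * pi) * \<i>" t S]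
    by (simp add: e_def[abs_def] e'_def cis_conv_exp scaleR_conv_of_real mult_ac)
  have e1: "e 1 = 1" "e 0 = 1" by (simp_all add: e_def)
  have step: "((\<lambda>t. if y < t then e' t else 0) has_integral 1 - e y) {0..1}"
    if "y \<in> {0..<1}" for y
  proof -
    have "(e' has_integral e 1 - e y) {y..1}"
      using that deriv by (intro fundamental_theorem_of_calculus) auto
    then have "((\<lambda>t. if t \<in> {y..1} then e' t else 0) has_integral 1 - e y) {0..1}"
      using that e1 by (subst has_integral_restrict) auto
    \<comment> \<open>The integrands with \<open>y \<le> t\<close> and \<open>y < t\<close> differ
      only at \<open>t = y\<close>; the strict form matches counting in [0,t).\<close>
    then show ?thesis
      by (rule has_integral_spike_finite[of "{y}", rotated 2]) auto
  qed
  have ramp: "((\<lambda>t. of_real t * e' t) has_integral 1) {0..1}"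
  proof -
    \<comment> \<open>An antiderivative found by integrating by parts.\<close>
    define G where "G t = of_real t * e t - e t / (2 * pi * \<i>)" for t :: real
    have "(G has_vector_derivative of_real t * e' t) (at t within {0..1})" for t
      unfolding G_def[abs_def]
      by (rule derivative_eq_intros deriv refl | simp add: e'_def)+
    then have "((\<lambda>t. of_real t * e' t) has_integral G 1 - G 0) {0..1}"
      by (intro fundamental_theorem_of_calculus) auto
    then show ?thesis by (simp add: G_def e1)
  qed
  define count where "count t = card {n \<in> {1..N}. x n \<in> {0..<t}}" for t
  \<comment> \<open>One ramp is subtracted per point: the ramps add up to the term N t, and their
    integrals cancel the constants 1 from \<open>step\<close>.\<close>
  define f where "f t = (\<Sum>n=1..N. (if x n < t then e' t else 0) - of_real t * e' t)" for t
  have "(f has_integral (\<Sum>n=1..N. 1 - e (x n) - 1)) {0..1}"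
    unfolding f_def[abs_def] by (intro has_integral_sum has_integral_diff step ramp x) auto
  then have integral: "(f has_integral - (\<Sum>n=1..N. e (x n))) (cbox 0 1)"
    by (simp add: sum_negf)
  have f_eq: "f t = of_real (real (count t) - real N * t) * e' t" for t
  proof -
    have "(\<Sum>n=1..N. if x n < t then e' t else 0) = (\<Sum>n | n \<in> {1..N} \<and> x n < t. e' t)"
      by (rule sum.inter_filter[symmetric]) simp
    also have "{n. n \<in> {1..N} \<and> x n < t} = {n \<in> {1..N}. x n \<in> {0..<t}}"
      using x by auto
    finally show ?thesis
      by (simp add: f_def sum_subtractf count_def algebra_simps)
  qed
  have discrepancy: "\<bar>real (count t) - real N * t\<bar> \<le> real N * star_discrepancy x N" if "t \<in> {0<..1}" for t
  proof -
    have "\<bar>real (count t) / real N - t\<bar> \<le> star_discrepancy x N"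
      unfolding star_discrepancy_def count_def
      by (rule cSUP_upper[OF that bdd_above_star_discrepancy])
    then have "real N * \<bar>real (count t) / real N - t\<bar> \<le> real N * star_discrepancy x N"
      by (intro mult_left_mono) auto
    moreover have "real N * \<bar>real (count t) / real N - t\<bar> = \<bar>real N * (real (count t) / real N - t)\<bar>"
      by (simp add: abs_mult)
    moreover have "real N * (real (count t) / real N - t) = real (count t) - real N * t"
      using \<open>N \<ge> 1\<close> by (simp add: right_diff_distrib)
    ultimately show ?thesis by simp
  qed
  have nonneg: "0 \<le> real N * star_discrepancy x N"
    using discrepancy[of 1] by (auto intro: order_trans[OF abs_ge_zero])
  \<comment> \<open>The supremum in the discrepancy omits 0, so \<open>t = 0\<close> is treated
    separately; there \<open>f\<close> vanishes.\<close>
  have "norm (f t) \<le> 2 * pi * (real N * star_discrepancy x N)" if "t \<in> cbox 0 1" for t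
  proof (cases "t = 0")
    case True
    then show ?thesis using nonneg by (simp add: f_eq count_def)
  next
    case False
    have "norm (f t) = 2 * pi * \<bar>real (count t) - real N * t\<bar>"
      by (simp add: f_eq norm_mult e'_def e_def del: of_real_diff)
    also have "\<dots> \<le> 2 * pi * (real N * star_discrepancy x N)"
      using False that by (intro mult_left_mono discrepancy) auto
    finally show ?thesis .
  qed
  from has_integral_bound[OF _ integral this] nonneg
  show ?thesis by (simp add: e_def)
qed

section \<open>Large discrepancy for every non-integer multiplier\<close>

lemma rudin_shapiro_discrepancy:
  assumes "\<alpha> \<notin> \<int>"
  shows "\<exists>\<^sub>\<infinity>N. sqrt (real N) / (32 * pi)
    \<le> real N * star_discrepancy (\<lambda>n. frac (real (rudin_shapiro_integer n) * \<alpha>)) N"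
  unfolding INFM_nat
proof
  fix K :: nat
  define z where "z = cis (2 * pi * \<alpha>)"
  have "z \<noteq> 1"
  proof
    assume "z = 1"
    then have "cos (2 * pi * \<alpha>) = 1" by (simp add: z_def complex_eq_iff)
    then obtain j :: int where "2 * pi * \<alpha> = of_int j * 2 * pi"
      using cos_one_2pi_int by blast
    then have "\<alpha> = of_int j" by simp
    then show False using assms by simp
  qed
  define C where "C = 2 / norm (z - 1)"
  \<comment> \<open>Since \<open>C\<close> will bound the geometric sum, the factor 8 makes that sum
    at most half of the lower bound sqrt(2^m)/4 for the polynomial.\<close>
  obtain M where "8 * C < sqrt 2 ^ M"
    using real_arch_pow[of "sqrt 2"] by auto
  then have M: "8 * C \<le> sqrt (2 ^ m)" if "M \<le> m" for m
  proof -
    have "sqrt 2 ^ M \<le> sqrt 2 ^ m" using that by (intro power_increasing) auto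
    then show ?thesis using \<open>8 * C < sqrt 2 ^ M\<close> unfolding real_sqrt_power by linarith
  qed
  have "norm z = 1" by (simp add: z_def)
  \<comment> \<open>\<open>M\<close> controls the geometric sum, \<open>K\<close> forces
    \<open>N > K\<close>, and 3 permits the density bound.\<close>
  then obtain m where m: "m \<ge> M + K + 3" and P: "norm (rs_poly m z) \<ge> sqrt (2 ^ m) / 4"
    using rs_poly_large by blast
  define N where "N = card (rs_below m)"
  have "2 ^ m \<le> 4 * N"
    unfolding N_def using m by (intro card_rs_below_ge) simp
  moreover have "4 * K < 2 ^ m"
  proof -
    have "4 * K < 4 * 2 ^ K" by simp
    also have "(4 :: nat) * 2 ^ K = 2 ^ (K + 2)" by simp
    also have "\<dots> \<le> 2 ^ m" using m by (intro power_increasing) auto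
    finally show ?thesis .
  qed
  ultimately have "K < N" by linarith
  have "norm (\<Sum>k<2 ^ m. z ^ k) = norm (z ^ 2 ^ m - 1) / norm (z - 1)"
    using \<open>z \<noteq> 1\<close> by (simp add: geometric_sum norm_divide)
  also have "\<dots> \<le> C"
    unfolding C_def using \<open>norm z = 1\<close> norm_triangle_ineq4[of "z ^ 2 ^ m" 1]
    by (intro divide_right_mono) (auto simp: norm_power)
  finally have geometric: "norm (\<Sum>k<2 ^ m. z ^ k) \<le> C" .
  have "(\<Sum>n=1..N. cis (2 * pi * frac (real (rudin_shapiro_integer n) * \<alpha>)))
      = (\<Sum>n=1..N. z ^ rudin_shapiro_integer n)"
  proof (rule sum.cong[OF refl])
    fix n
    have "2 * pi * frac (real (rudin_shapiro_integer n) * \<alpha>) =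
        real (rudin_shapiro_integer n) * (2 * pi * \<alpha>) - 2 * pi * of_int \<lfloor>real (rudin_shapiro_integer n) * \<alpha>\<rfloor>"
      by (simp add: frac_def algebra_simps)
    then have "cis (2 * pi * frac (real (rudin_shapiro_integer n) * \<alpha>))
        = cis (real (rudin_shapiro_integer n) * (2 * pi * \<alpha>))"
      by (simp flip: cis_divide)
    then show "cis (2 * pi * frac (real (rudin_shapiro_integer n) * \<alpha>)) = z ^ rudin_shapiro_integer n"
      unfolding z_def Complex.DeMoivre .
  qed
  also have "\<dots> = (\<Sum>k\<in>rs_below m. z ^ k)"
    using sum.reindex[OF inj_on_rudin_shapiro_integer, of "\<lambda>k. z ^ k" N]
    unfolding N_def rudin_shapiro_integer_image o_def by (rule sym)
  finally have sum_eq: "(\<Sum>n=1..N. cis (2 * pi * frac (real (rudin_shapiro_integer n) * \<alpha>)))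
      = ((\<Sum>k<2 ^ m. z ^ k) + rs_poly m z) / 2"
    by (simp add: rs_below_power_sum)
  have "real N \<le> 2 ^ m"
    using card_rs_below_le[of m] unfolding N_def by (metis of_nat_le_iff of_nat_numeral of_nat_power)
  then have "sqrt (real N) / 16 \<le> sqrt (2 ^ m) / 16"
    by simp
  \<comment> \<open>The remaining sqrt(2^m)/8 is halved by the indicator formula; Koksma's factor 2
    pi then turns 16 into 32 pi.\<close>
  also have "\<dots> \<le> (norm (rs_poly m z) - norm (\<Sum>k<2 ^ m. z ^ k)) / 2"
    using P geometric M[OF add_leD1[OF add_leD1[OF m]]] by argo
  also have "\<dots> \<le> norm (\<Sum>n=1..N. cis (2 * pi * frac (real (rudin_shapiro_integer n) * \<alpha>)))"
    unfolding sum_eq using norm_diff_ineq[of "rs_poly m z" "\<Sum>k<2 ^ m. z ^ k"]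
    by (simp add: norm_divide add.commute)
  also have "\<dots> \<le> 2 * pi * (real N * star_discrepancy (\<lambda>n. frac (real (rudin_shapiro_integer n) * \<alpha>)) N)"
    using \<open>K < N\<close> by (intro norm_exponential_sum_le_star_discrepancy) (auto simp: frac_lt_1)
  finally have "sqrt (real N) / (32 * pi)
      \<le> real N * star_discrepancy (\<lambda>n. frac (real (rudin_shapiro_integer n) * \<alpha>)) N"
    by (simp add: field_simps)
  with \<open>K < N\<close> show "\<exists>N>K. sqrt (real N) / (32 * pi)
      \<le> real N * star_discrepancy (\<lambda>n. frac (real (rudin_shapiro_integer n) * \<alpha>)) N"
    by blast
qed

theorem theorem4:
  shows "(\<exists>c>0::real. \<forall>N\<ge>1.
            real (additive_energy ((\<lambda>n. int (rudin_shapiro_integer n)) ` {1..N})) \<ge> c * real N ^ 3)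
       \<and> (AE \<alpha> in lebesgue. \<forall>\<epsilon>>0::real. \<exists>c>0::real. \<exists>\<^sub>\<infinity>N.
            real N * star_discrepancy (\<lambda>n. frac (real (rudin_shapiro_integer n) * \<alpha>)) N
              \<ge> c * real N powr (1 / 2 - \<epsilon>))"
proof
  show "\<exists>c>0::real. \<forall>N\<ge>1.
      real (additive_energy ((\<lambda>n. int (rudin_shapiro_integer n)) ` {1..N})) \<ge> c * real N ^ 3"
    by (intro exI[of _ "1 / 32"] conjI allI impI additive_energy_rudin_shapiro) simp_all
next
  \<comment> \<open>The exceptional multipliers lie in the integers, a countable and hence null
    set.\<close>
  have "(\<int> :: real set) \<in> null_sets lborel"
    by (rule countable_imp_null_set_lborel) (simp add: Ints_def)
  then have "AE \<alpha> in lebesgue. \<alpha> \<notin> (\<int> :: real set)"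
    by (intro AE_not_in null_sets_completionI)
  then show "AE \<alpha> in lebesgue. \<forall>\<epsilon>>0::real. \<exists>c>0::real. \<exists>\<^sub>\<infinity>N.
      real N * star_discrepancy (\<lambda>n. frac (real (rudin_shapiro_integer n) * \<alpha>)) N
        \<ge> c * real N powr (1 / 2 - \<epsilon>)"
  proof (eventually_elim, intro allI impI)
    fix \<alpha> \<epsilon> :: real
    assume "\<alpha> \<notin> \<int>" "\<epsilon> > 0"
    \<comment> \<open>A single constant serves all multipliers and exponents. For N >= 1 the power
      increases with its exponent; at N = 0 both sides are 0.\<close>
    have le: "1 / (32 * pi) * real N powr (1 / 2 - \<epsilon>) \<le> sqrt (real N) / (32 * pi)" for N
    proof (cases "N = 0")
      case False
      then have "real N powr (1 / 2 - \<epsilon>) \<le> real N powr (1 / 2)"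
        using \<open>\<epsilon> > 0\<close> by (intro powr_mono) auto
      then show ?thesis using False by (simp add: powr_half_sqrt divide_right_mono)
    qed simp
    show "\<exists>c>0::real. \<exists>\<^sub>\<infinity>N.
        real N * star_discrepancy (\<lambda>n. frac (real (rudin_shapiro_integer n) * \<alpha>)) N
          \<ge> c * real N powr (1 / 2 - \<epsilon>)"
    proof (intro exI conjI)
      show "\<exists>\<^sub>\<infinity>N. real N * star_discrepancy (\<lambda>n. frac (real (rudin_shapiro_integer n) * \<alpha>)) N
          \<ge> 1 / (32 * pi) * real N powr (1 / 2 - \<epsilon>)"
        using rudin_shapiro_discrepancy[OF \<open>\<alpha> \<notin> \<int>\<close>] by (rule INFM_mono) (rule order_trans[OF le])
    qed simp
  qed
qed

end
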